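(* Let $\beta>0$, $(t_1,t_2)\in\mathbb{R}^2$, and let $Z$ be the moving maximum process on $\mathbb{R}^2$ generated by the density $\phi(u_1,u_2)=\frac{\beta^2}{4}\exp\{-\beta(|u_1|+|u_2|)\}$. Write $a\wedge b=\min(a,b)$, $a\vee b=\max(a,b)$. Then for all $w_1,w_2>0$, $-\log P\{Z(0,0)\le w_1,\ Z(t_1,t_2)\le w_2\}$ equals $$\begin{cases}\dfrac1{w_1}, & (w_1,w_2)\in A_1,\\[2mm] \dfrac1{w_1}+\dfrac1{w_2}-\dfrac{1}{\sqrt{w_1w_2}}e^{-\beta(|t_1|+|t_2|)/2}\left[1+\beta\dfrac{|t_1|+|t_2|}{4}+\dfrac14\ln\left(\dfrac{w_1}{w_2}\right)\right], & (w_1,w_2)\in A_2,\\[2mm] \dfrac1{w_1}+\dfrac1{w_2}-\dfrac{1}{\sqrt{w_1w_2}}e^{-\beta(|t_1|+|t_2|)/2}\left[1+\beta\dfrac{\min(|t_1|,|t_2|)}{2}\right], & (w_1,w_2)\in A_3,\\[2mm] \dfrac1{w_1}+\dfrac1{w_2}-\dfrac{1}{\sqrt{w_1w_2}}e^{-\beta(|t_1|+|t_2|)/2}\left[1+\beta\dfrac{|t_1|+|t_2|}{4}+\dfrac14\ln\left(\dfrac{w_2}{w_1}\right)\right], & (w_1,w_2)\in A_4,\\[2mm] \dfrac1{w_2}, & (w_1,w_2)\in A_5,\end{cases}$$ where $$A_1=\{(w_1,w_2):\tfrac1\beta\ln(\tfrac{w_1}{w_2})<-(|t_1|+|t_2|)\},$$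 $$A_2=\{(w_1,w_2):-(|t_1|+|t_2|)\le\tfrac1\beta\ln(\tfrac{w_1}{w_2})<|t_1|\wedge|t_2|-|t_1|\vee|t_2|\},$$ $$A_3=\{(w_1,w_2):|t_1|\wedge|t_2|-|t_1|\vee|t_2|\le\tfrac1\beta\ln(\tfrac{w_1}{w_2})<|t_1|\vee|t_2|-|t_1|\wedge|t_2|\},$$ $$A_4=\{(w_1,w_2):|t_1|\vee|t_2|-|t_1|\wedge|t_2|\le\tfrac1\beta\ln(\tfrac{w_1}{w_2})<|t_1|+|t_2|\},$$ $$A_5=\{(w_1,w_2):\tfrac1\beta\ln(\tfrac{w_1}{w_2})\ge|t_1|+|t_2|\}.$$
   Context: For a unimodal (nonincreasing in each direction starting from the mode) continuous probability density $\phi$ on $\mathbb{R}^2$, let $\{(X_j,W_j,Y_j)\}_{j\ge1}$ be the points of a homogeneous (unit intensity) Poisson process on $\mathbb{R}^2\times\mathbb{R}_+$. The moving maximum process on $\mathbb{R}^2$ generated by $\phi$ is $$Z(t_1,t_2):=\max_{j\ge1}\frac{\phi(X_j-t_1,W_j-t_2)}{Y_j},\qquad (t_1,t_2)\in\mathbb{R}^2.$$ It is stationary and simple max-stable, and for $\mathbf{t}_i\in\mathbb{R}^2$, $x_i>0$, $$P\{Z(\mathbf{t}_1)\le x_1,\dots,Z(\mathbf{t}_d)\le x_d\}=\exp\left\{-\int_{\mathbb{R}^2}\max_{1\le i\le d}\frac{\phi(\mathbf{s}-\mathbf{t}_i)}{x_i}\,d\mathbf{s}\right\}.$$ *)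

theory Defs
  imports "HOL-Probability.Probability"
begin

text \<open>The number of points of the sequence \<open>P\<close> in \<open>B\<close>, with multiplicity. It is
  \<open>ennreal\<close>-valued because it may be infinite (where \<open>card\<close> would return 0).\<close>

definition point_count :: "(nat \<Rightarrow> 'a \<Rightarrow> 'b) \<Rightarrow> 'b set \<Rightarrow> 'a \<Rightarrow> ennreal" where
  "point_count P B \<omega> = emeasure (count_space UNIV) {j. P j \<omega> \<in> B}"

text \<open>Poisson processes with intensity measure \<open>\<Lambda>\<close> given by a measurable enumeration of their
  points. Since every index \<open>j\<close> is a point, this is meant for \<open>\<Lambda>\<close> of infinite total mass. That a
  set of infinite intensity almost surely contains infinitely many points is a consequence
  for \<open>\<sigma>\<close>-finite \<open>\<Lambda>\<close>. For intensity 0 the formula below uses \<open>0 ^ 0 = 1\<close>.\<close>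

definition (in prob_space) poisson_process :: "'b measure \<Rightarrow> (nat \<Rightarrow> 'a \<Rightarrow> 'b) \<Rightarrow> bool" where
  "poisson_process \<Lambda> P \<longleftrightarrow>
     (\<forall>j. random_variable \<Lambda> (P j)) \<and>
     (\<forall>B\<in>sets \<Lambda>. emeasure \<Lambda> B < \<infinity> \<longrightarrow>
        (\<forall>k::nat. prob {\<omega>\<in>space M. point_count P B \<omega> = of_nat k}
                  = measure \<Lambda> B ^ k / fact k * exp (- measure \<Lambda> B))) \<and>
     (\<forall>(I :: nat set) B. finite I \<and> B ` I \<subseteq> sets \<Lambda> \<and> disjoint_family_on B I \<longrightarrow>
        indep_vars (\<lambda>_. borel) (\<lambda>i. point_count P (B i)) I)"

text \<open>Unit intensity on \<open>\<real>\<^sup>2 \<times> (0,\<infinity>)\<close>; the points then lie in this set surely, so that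
  dividing by the last coordinate is meaningful.\<close>

definition unit_intensity :: "(real \<times> real \<times> real) measure" where
  "unit_intensity = restrict_space lborel (UNIV \<times> UNIV \<times> {0<..})"

text \<open>The maximum over the infinitely many points is attained only almost surely, hence it is
  written as a supremum in the extended reals.\<close>

definition moving_max :: "(real \<Rightarrow> real \<Rightarrow> real) \<Rightarrow> (nat \<Rightarrow> 'a \<Rightarrow> real) \<Rightarrow> (nat \<Rightarrow> 'a \<Rightarrow> real) \<Rightarrow>
    (nat \<Rightarrow> 'a \<Rightarrow> real) \<Rightarrow> real \<times> real \<Rightarrow> 'a \<Rightarrow> ereal" where
  "moving_max \<phi> X W Y = (\<lambda>(t1, t2) \<omega>. SUP j. ereal (\<phi> (X j \<omega> - t1) (W j \<omega> - t2) / Y j \<omega>))"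

definition laplace_density2 :: "real \<Rightarrow> real \<Rightarrow> real \<Rightarrow> real" where
  "laplace_density2 \<beta> u1 u2 = \<beta>\<^sup>2 / 4 * exp (- \<beta> * (\<bar>u1\<bar> + \<bar>u2\<bar>))"

definition A1 :: "real \<Rightarrow> real \<Rightarrow> real \<Rightarrow> (real \<times> real) set" where
  "A1 \<beta> t1 t2 = {(w1, w2). 1 / \<beta> * ln (w1 / w2) < - (\<bar>t1\<bar> + \<bar>t2\<bar>)}"

definition A2 :: "real \<Rightarrow> real \<Rightarrow> real \<Rightarrow> (real \<times> real) set" where
  "A2 \<beta> t1 t2 = {(w1, w2). - (\<bar>t1\<bar> + \<bar>t2\<bar>) \<le> 1 / \<beta> * ln (w1 / w2) \<and>
     1 / \<beta> * ln (w1 / w2) < min \<bar>t1\<bar> \<bar>t2\<bar> - max \<bar>t1\<bar> \<bar>t2\<bar>}"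

definition A3 :: "real \<Rightarrow> real \<Rightarrow> real \<Rightarrow> (real \<times> real) set" where
  "A3 \<beta> t1 t2 = {(w1, w2). min \<bar>t1\<bar> \<bar>t2\<bar> - max \<bar>t1\<bar> \<bar>t2\<bar> \<le> 1 / \<beta> * ln (w1 / w2) \<and>
     1 / \<beta> * ln (w1 / w2) < max \<bar>t1\<bar> \<bar>t2\<bar> - min \<bar>t1\<bar> \<bar>t2\<bar>}"

definition A4 :: "real \<Rightarrow> real \<Rightarrow> real \<Rightarrow> (real \<times> real) set" where
  "A4 \<beta> t1 t2 = {(w1, w2). max \<bar>t1\<bar> \<bar>t2\<bar> - min \<bar>t1\<bar> \<bar>t2\<bar> \<le> 1 / \<beta> * ln (w1 / w2) \<and>
     1 / \<beta> * ln (w1 / w2) < \<bar>t1\<bar> + \<bar>t2\<bar>}"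

definition A5 :: "real \<Rightarrow> real \<Rightarrow> real \<Rightarrow> (real \<times> real) set" where
  "A5 \<beta> t1 t2 = {(w1, w2). 1 / \<beta> * ln (w1 / w2) \<ge> \<bar>t1\<bar> + \<bar>t2\<bar>}"

lemma A_cover: "A1 \<beta> t1 t2 \<union> A2 \<beta> t1 t2 \<union> A3 \<beta> t1 t2 \<union> A4 \<beta> t1 t2 \<union> A5 \<beta> t1 t2 = UNIV"
  unfolding A1_def A2_def A3_def A4_def A5_def by auto

end

theory Submission
  imports Defs
begin

text \<open>The event is the absence of Poisson points below the graph of
  \<open>max (\<phi>(s) / w\<^sub>1) (\<phi>(s - t) / w\<^sub>2)\<close>, so \<open>L\<close> is the integral of this maximum, that is
  \<open>1 / w\<^sub>1 + 1 / w\<^sub>2\<close> minus the integral of the minimum. Put \<open>k = \<beta> / 2\<close>, \<open>c = ln (w\<^sub>1 / w\<^sub>2) / \<beta>\<close> and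
  \<open>U\<^sub>i = \<bar>s\<^sub>i\<bar> - \<bar>s\<^sub>i - t\<^sub>i\<bar>\<close>. From \<open>min e\<^sup>x e\<^sup>y = e\<^bsup>(x + y) / 2\<^esup> e\<^bsup>- \<bar>x - y\<bar> / 2\<^esup>\<close>, the minimum is
  \<open>1 / sqrt (w\<^sub>1 w\<^sub>2)\<close> times the product of the weights \<open>k exp (- k (\<bar>s\<^sub>i\<bar> + \<bar>s\<^sub>i - t\<^sub>i\<bar>))\<close> and of
  \<open>exp (- k \<bar>U\<^sub>1 + U\<^sub>2 + c\<bar>)\<close>. Under such a weight, \<open>U\<^sub>i\<close> has two equal atoms at \<open>\<plusminus>\<bar>t\<^sub>i\<bar>\<close> and a constant density
  between them. Integrating over the coordinate with the larger \<open>\<bar>t\<^sub>i\<bar>\<close> first turns the exponential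
  into \<open>exp (- k max (\<bar>x\<bar> - \<bar>t\<^sub>i\<bar>) 0)\<close> with \<open>x = U\<^sub>j + c\<close>, and the second integration is then elementary.\<close>

section \<open>One-dimensional integrals against the overlap weight of two shifted Laplace
  densities\<close>

text \<open>Reflection reduces to \<open>t \<ge> 0\<close>. Left of 0 and right of \<open>t\<close>
  the argument of \<open>F\<close> is constantly \<open>- t\<close> or \<open>t\<close>, and each
  tail carries mass \<open>exp (- k * t) / 2\<close>; these are the atoms. In between, the weight is
  constantly \<open>k * exp (- k * t)\<close> and the argument runs through \<open>{- t..t}\<close>
  at speed 2, whence the common factor 1/2.\<close>

lemma laplace_overlap_nn_integral:
  fixes k t I :: real and F :: "real \<Rightarrow> real"
  assumes k: "k > 0" and [measurable]: "F \<in> borel_measurable borel" and F0: "\<And>u. F u \<ge> 0"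
    and I: "(F has_integral I) {-\<bar>t\<bar>..\<bar>t\<bar>}"
  shows "(\<integral>\<^sup>+s. ennreal (k * exp (- k * (\<bar>s\<bar> + \<bar>s - t\<bar>)) * F (\<bar>s\<bar> - \<bar>s - t\<bar>)) \<partial>lborel)
    = ennreal (exp (- k * \<bar>t\<bar>) * ((F \<bar>t\<bar> + F (- \<bar>t\<bar>) + k * I) / 2))"
proof -
  have I0: "I \<ge> 0" using has_integral_nonneg[OF I] F0 by blast
  have upper: "(\<integral>\<^sup>+s. ennreal (exp (- (2 * k) * s)) * indicator {c..} s \<partial>lborel)
      = ennreal (exp (- (2 * k) * c) / (2 * k))" for c
    by (rule nn_integral_has_integral_lebesgue') (use k has_integral_exp_minus_to_infinity[of "2*k" c] in auto)
  have lower: "(\<integral>\<^sup>+s. ennreal (exp ((2 * k) * s)) * indicator {..0} s \<partial>lborel) = ennreal (1 / (2 * k))"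
  proof -
    have "(\<integral>\<^sup>+s. ennreal (exp ((2 * k) * s)) * indicator {..0} s \<partial>lborel)
      = (\<integral>\<^sup>+s. ennreal (exp (- (2 * k) * s)) * indicator {0..} s \<partial>lborel)"
      by (subst nn_integral_real_affine[where c = "-1" and t = 0])
        (auto intro!: nn_integral_cong simp: indicator_def)
    then show ?thesis using upper[of 0] by simp
  qed
  have pos: "(\<integral>\<^sup>+s. ennreal (k * exp (- k * (\<bar>s\<bar> + \<bar>s - a\<bar>)) * F (\<bar>s\<bar> - \<bar>s - a\<bar>)) \<partial>lborel)
    = ennreal (exp (- k * a) * ((F a + F (- a) + k * I) / 2))" (is "?L = _")
    if a: "a \<ge> 0" and Ia: "(F has_integral I) {-a..a}" for a
  proof -
    have "((\<lambda>s. F (2 *\<^sub>R s + - a)) has_integral (I /\<^sub>R 2 ^ DIM(real))) (cbox ((- a - - a) /\<^sub>R 2) ((a - - a) /\<^sub>R 2))"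
      using Ia by (intro has_integral_affinity') auto
    then have "((\<lambda>s. F (2 * s - a)) has_integral (I / 2)) {0..a}"
      by (simp add: field_simps)
    then have middle: "(\<integral>\<^sup>+s. ennreal (F (2 * s - a)) * indicator {0..a} s \<partial>lborel) = ennreal (I / 2)"
      by (intro nn_integral_has_integral_lebesgue') (use F0 in auto)
    \<comment> \<open>At 0 and \<open>a\<close> the closed pieces overlap and are counted more than
      once, so the decomposition is stated almost everywhere.\<close>
    have eq: "AE s in lborel. ennreal (k * exp (- k * (\<bar>s\<bar> + \<bar>s - a\<bar>)) * F (\<bar>s\<bar> - \<bar>s - a\<bar>)) =
        ennreal (k * exp (- k * a) * F (- a)) * (ennreal (exp ((2 * k) * s)) * indicator {..0} s)
      + ennreal (k * exp (- k * a)) * (ennreal (F (2 * s - a)) * indicator {0..a} s)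
      + ennreal (k * exp (k * a) * F a) * (ennreal (exp (- (2 * k) * s)) * indicator {a..} s)"
      using AE_lborel_singleton[of 0] AE_lborel_singleton[of a]
    proof eventually_elim
      case (elim s)
      consider "s < 0" | "0 < s" "s < a" | "s > a" using elim by linarith
      then show ?case
      proof cases
        case 1
        with a have "\<bar>s\<bar> = - s" "\<bar>s - a\<bar> = a - s" by auto
        with 1 a k F0[of "-a"] show ?thesis
          by (simp add: ennreal_mult[symmetric] exp_add[symmetric] algebra_simps mult_exp_exp)
      next
        case 2
        then have "\<bar>s\<bar> = s" "\<bar>s - a\<bar> = a - s" by auto
        with 2 a k F0[of "2 * s - a"] show ?thesis
          by (simp add: ennreal_mult[symmetric] algebra_simps)
      next
        case 3
        with a have "\<bar>s\<bar> = s" "\<bar>s - a\<bar> = s - a" by auto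
        with 3 a k F0[of "a"] show ?thesis
          by (simp add: ennreal_mult[symmetric] algebra_simps mult_exp_exp)
      qed
    qed
    have "?L = ennreal (k * exp (- k * a) * F (- a)) * ennreal (1 / (2 * k))
      + ennreal (k * exp (- k * a)) * ennreal (I / 2)
      + ennreal (k * exp (k * a) * F a) * ennreal (exp (- (2 * k) * a) / (2 * k))"
      unfolding nn_integral_cong_AE[OF eq]
      by (simp add: nn_integral_add nn_integral_cmult lower[simplified] middle[simplified] upper[simplified])
    also have "\<dots> = ennreal (k * exp (- k * a) * F (- a) * (1 / (2 * k)) + k * exp (- k * a) * (I / 2)
        + k * exp (k * a) * F a * (exp (- (2 * k) * a) / (2 * k)))"
      using k F0 I0 by (simp add: ennreal_mult[symmetric] ennreal_plus[symmetric] del: ennreal_plus)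
    also have "k * exp (k * a) * F a * (exp (- (2 * k) * a) / (2 * k)) = (exp (k * a) * exp (- (2 * k) * a)) * F a / 2"
      using k by simp
    also have "exp (k * a) * exp (- (2 * k) * a) = exp (- k * a)"
      by (simp add: mult_exp_exp)
    finally show ?thesis using k by (simp add: field_simps)
  qed
  show ?thesis
  proof (cases "t \<ge> 0")
    case True
    then show ?thesis using pos[of t] I by simp
  next
    case False
    have "(\<integral>\<^sup>+s. ennreal (k * exp (- k * (\<bar>s\<bar> + \<bar>s - t\<bar>)) * F (\<bar>s\<bar> - \<bar>s - t\<bar>)) \<partial>lborel)
      = (\<integral>\<^sup>+s. ennreal (k * exp (- k * (\<bar>s\<bar> + \<bar>s - (-t)\<bar>)) * F (\<bar>s\<bar> - \<bar>s - (-t)\<bar>)) \<partial>lborel)"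
      by (subst nn_integral_real_affine[where c = "-1" and t = 0])
        (auto intro!: nn_integral_cong simp: abs_minus_commute add.commute)
    then show ?thesis using pos[of "-t"] I False by simp
  qed
qed

text \<open>\<open>H\<close> is the antiderivative of \<open>exp (- k * \<bar>y\<bar>)\<close>
  vanishing at 0. With \<open>min\<close> and \<open>max\<close>, one of its exponentials equals 1
  on each side of 0, so a single continuous formula serves both signs; the branch change at
  \<open>u = - x\<close> is passed as an exceptional point.\<close>

lemma has_integral_exp_abs_shift:
  fixes k a x :: real
  assumes k: "k > 0" and a: "a \<ge> 0"
  defines "H \<equiv> \<lambda>y. (exp (k * min y 0) - exp (- k * max y 0)) / k"
  shows "((\<lambda>u. exp (- k * \<bar>u + x\<bar>)) has_integral (H (a + x) - H (- a + x))) {-a..a}"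
proof (rule fundamental_theorem_of_calculus_interior_strong[of "{-x}"])
  show "continuous_on {- a..a} (\<lambda>u. H (u + x))"
    unfolding H_def by (intro continuous_intros) (use k in auto)
  fix u assume "u \<in> {- a<..<a} - {- x}"
  then consider "u + x < 0" | "u + x > 0" by fastforce
  then have "((\<lambda>u. H (u + x)) has_real_derivative exp (- k * \<bar>u + x\<bar>)) (at u)"
  proof cases
    case 1
    have "((\<lambda>u. (exp (k * (u + x)) - 1) / k) has_real_derivative exp (k * (u + x))) (at u)"
      using k by (auto intro!: derivative_eq_intros)
    also have "exp (k * (u + x)) = exp (- k * \<bar>u + x\<bar>)"
      by (simp only: abs_of_neg[OF 1] mult_minus_left mult_minus_right minus_minus)
    finally have "((\<lambda>u. (exp (k * (u + x)) - 1) / k) has_real_derivative exp (- k * \<bar>u + x\<bar>)) (at u)" .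
    then show ?thesis
      by (rule has_field_derivative_transform_within_open[of _ _ _ "{..<-x}"]) (use 1 in \<open>auto simp: H_def\<close>)
  next
    case 2
    have "((\<lambda>u. (1 - exp (- k * (u + x))) / k) has_real_derivative exp (- k * \<bar>u + x\<bar>)) (at u)"
      using 2 k by (auto intro!: derivative_eq_intros)
    then show ?thesis
      by (rule has_field_derivative_transform_within_open[of _ _ _ "{-x<..}"]) (use 2 in \<open>auto simp: H_def\<close>)
  qed
  then show "((\<lambda>u. H (u + x)) has_vector_derivative exp (- k * \<bar>u + x\<bar>)) (at u)"
    by (simp add: has_real_derivative_iff_has_vector_derivative)
qed (use a in auto)

text \<open>This is the inner integration. The boundary values of the antiderivative combine with
  the atoms at \<open>\<plusminus>\<bar>t\<bar>\<close> so that only decay in the distance of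
  \<open>x\<close> from \<open>{-\<bar>t\<bar>..\<bar>t\<bar>}\<close> remains.\<close>

lemma laplace_overlap_exp_abs:
  fixes k t x :: real
  assumes k: "k > 0"
  shows "(\<integral>\<^sup>+s. ennreal (k * exp (- k * (\<bar>s\<bar> + \<bar>s - t\<bar>)) * exp (- k * \<bar>\<bar>s\<bar> - \<bar>s - t\<bar> + x\<bar>)) \<partial>lborel)
    = ennreal (exp (- k * \<bar>t\<bar>) * exp (- k * max (\<bar>x\<bar> - \<bar>t\<bar>) 0))"
proof -
  define a where "a = \<bar>t\<bar>"
  define H where "H \<equiv> \<lambda>y::real. (exp (k * min y 0) - exp (- k * max y 0)) / k"
  have a: "a \<ge> 0" by (simp add: a_def)
  have kH: "k * H y = exp (k * min y 0) - exp (- k * max y 0)" for y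
    using k by (simp add: H_def)
  \<comment> \<open>In the cases below, \<open>p\<close> and \<open>q\<close> are the values of the
    kernel at the atoms \<open>a\<close> and \<open>- a\<close>. For \<open>x\<close> left of the
    interval \<open>p\<close> survives, right of it \<open>q\<close>, and inside it only the
    constants.\<close>
  have eq: "(exp (- k * \<bar>a + x\<bar>) + exp (- k * \<bar>- a + x\<bar>) + (k * H (a + x) - k * H (- a + x))) / 2
      = exp (- k * max (\<bar>x\<bar> - a) 0)"
  proof -
    consider "x < - a" | "- a \<le> x" "x \<le> a" | "a < x" by linarith
    then show ?thesis
    proof cases
      case 1
      with a have *: "\<bar>a + x\<bar> = - a - x" "\<bar>- a + x\<bar> = a - x" "\<bar>x\<bar> = - x" by auto
      with 1 a have **: "min (a + x) 0 = a + x" "max (a + x) 0 = 0" "min (- a + x) 0 = - a + x" "max (- a + x) 0 = 0"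
        "max (- x - a) 0 = - x - a" by auto
      have ***: "- k * (- a - x) = k * (a + x)" "- k * (a - x) = k * (- a + x)" "- k * (- x - a) = k * (a + x)"
        by (simp_all add: algebra_simps)
      have "(p + q + (p - 1 - (q - 1))) / 2 = p" for p q :: real by simp
      then show ?thesis unfolding kH * ** *** mult_zero_right exp_zero .
    next
      case 2
      then have *: "\<bar>a + x\<bar> = a + x" "\<bar>- a + x\<bar> = a - x" "\<bar>x\<bar> \<le> a" by auto
      with 2 have **: "min (a + x) 0 = 0" "max (a + x) 0 = a + x" "min (- a + x) 0 = - a + x" "max (- a + x) 0 = 0"
        "max (\<bar>x\<bar> - a) 0 = 0" by auto
      have ***: "- k * (a - x) = k * (- a + x)"
        by (simp_all add: algebra_simps)
      have "(p + q + (1 - p - (q - 1))) / 2 = 1" for p q :: real by simp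
      then show ?thesis unfolding kH * ** *** mult_zero_right exp_zero .
    next
      case 3
      with a have *: "\<bar>a + x\<bar> = a + x" "\<bar>- a + x\<bar> = x - a" "\<bar>x\<bar> = x" by auto
      with 3 a have **: "min (a + x) 0 = 0" "max (a + x) 0 = a + x" "min (- a + x) 0 = 0" "max (- a + x) 0 = - a + x"
        "max (x - a) 0 = x - a" by auto
      have ***: "- k * (- a + x) = - k * (x - a)"
        by (simp_all add: algebra_simps)
      have "(p + q + (1 - p - (1 - q))) / 2 = q" for p q :: real by simp
      then show ?thesis unfolding kH * ** *** mult_zero_right exp_zero .
    qed
  qed
  have "((\<lambda>u. exp (- k * \<bar>u + x\<bar>)) has_integral (H (a + x) - H (- a + x))) {-\<bar>t\<bar>..\<bar>t\<bar>}"
    using has_integral_exp_abs_shift[OF k a, of x] unfolding H_def a_def .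
  from laplace_overlap_nn_integral[OF k _ _ this] show ?thesis
    unfolding a_def[symmetric] right_diff_distrib eq by (auto simp del: mult_minus_left)
qed

text \<open>Since \<open>b \<le> a\<close> and \<open>c \<ge> 0\<close>, \<open>v + c\<close> never
  drops below \<open>- a\<close>, so an excess occurs only above \<open>a\<close> and the absolute
  value disappears. \<open>H\<close> has slope 1 up to \<open>a\<close> and exponentially decaying
  slope beyond it; subtracting \<open>E y / k\<close> on both sides of \<open>a\<close> keeps it
  continuous.\<close>

lemma has_integral_exp_excess:
  fixes k a b c :: real
  assumes k: "k > 0" and b: "0 \<le> b" "b \<le> a" and c: "c \<ge> 0"
  defines "E \<equiv> \<lambda>y. exp (- k * max (y - a) 0)"
  defines "H \<equiv> \<lambda>y. min y a - E y / k"
  shows "((\<lambda>v. exp (- k * max (\<bar>v + c\<bar> - a) 0)) has_integral (H (b + c) - H (- b + c))) {-b..b}"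
proof (rule fundamental_theorem_of_calculus_interior_strong[of "{a-c}"])
  show "continuous_on {- b..b} (\<lambda>v. H (v + c))"
    unfolding H_def E_def by (intro continuous_intros) (use k in auto)
  fix v assume v: "v \<in> {- b<..<b} - {a - c}"
  then have E: "exp (- k * max (\<bar>v + c\<bar> - a) 0) = E (v + c)"
    using b c by (auto simp: E_def max_def abs_if)
  consider "v + c < a" | "v + c > a" using v by fastforce
  then have "((\<lambda>v. H (v + c)) has_real_derivative E (v + c)) (at v)"
  proof cases
    case 1
    have "((\<lambda>v. v + c - 1 / k) has_real_derivative E (v + c)) (at v)"
      using 1 by (auto intro!: derivative_eq_intros simp: E_def)
    then show ?thesis
      by (rule has_field_derivative_transform_within_open[of _ _ _ "{..<a-c}"]) (use 1 in \<open>auto simp: H_def E_def\<close>)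
  next
    case 2
    have "((\<lambda>v. a - exp (- k * (v + c - a)) / k) has_real_derivative E (v + c)) (at v)"
      using 2 k by (auto intro!: derivative_eq_intros simp: E_def)
    then show ?thesis
      by (rule has_field_derivative_transform_within_open[of _ _ _ "{a-c<..}"]) (use 2 in \<open>auto simp: H_def E_def\<close>)
  qed
  then show "((\<lambda>v. H (v + c)) has_vector_derivative exp (- k * max (\<bar>v + c\<bar> - a) 0)) (at v)"
    by (simp only: has_real_derivative_iff_has_vector_derivative E)
qed (use b in auto)

lemma laplace_overlap_exp_excess:
  fixes k a t c :: real
  assumes k: "k > 0" and a: "\<bar>t\<bar> \<le> a"
  shows "(\<integral>\<^sup>+s. ennreal (k * exp (- k * (\<bar>s\<bar> + \<bar>s - t\<bar>)) *
      exp (- k * max (\<bar>\<bar>s\<bar> - \<bar>s - t\<bar> + c\<bar> - a) 0)) \<partial>lborel)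
    = ennreal (exp (- k * max (\<bar>t\<bar>) (\<bar>c\<bar> - a)) * (1 + k * max 0 (min \<bar>t\<bar> ((a + \<bar>t\<bar> - \<bar>c\<bar>) / 2))))"
proof -
  define b where "b = \<bar>t\<bar>"
  define d where "d = \<bar>c\<bar>"
  define F where "F \<equiv> \<lambda>c v. exp (- k * max (\<bar>v + c\<bar> - a) 0)"
  define E where "E \<equiv> \<lambda>y. exp (- k * max (y - a) 0)"
  define H where "H \<equiv> \<lambda>y. min y a - E y / k"
  have b: "0 \<le> b" "b \<le> a" and d: "d \<ge> 0" using a by (auto simp: b_def d_def)
  have int: "(F d has_integral (H (b + d) - H (- b + d))) {-b..b}"
    unfolding F_def H_def E_def by (rule has_integral_exp_excess[OF k b d])
  \<comment> \<open>Reflecting \<open>v\<close> changes the sign of \<open>c\<close>, while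
    \<open>{- b..b}\<close> and the pair of atoms are symmetric; hence \<open>c\<close> may be
    replaced by \<open>d\<close>.\<close>
  have refl: "F (- c) v = F c (- v)" for c v
    by (simp add: F_def abs_minus_commute add.commute)
  have "(F c has_integral (H (b + d) - H (- b + d))) {-b..b}"
  proof (cases "c \<ge> 0")
    case False
    then have "F c = (\<lambda>v. F d (- v))" by (auto simp: d_def refl[symmetric])
    moreover have "((\<lambda>v. F d (- v)) has_integral (H (b + d) - H (- b + d))) {-b..- (- b)}"
      using int by (simp only: has_integral_reflect_real)
    ultimately show ?thesis by (simp only: minus_minus)
  qed (use int in \<open>simp add: d_def\<close>)
  then have *: "(\<integral>\<^sup>+s. ennreal (k * exp (- k * (\<bar>s\<bar> + \<bar>s - t\<bar>)) * F c (\<bar>s\<bar> - \<bar>s - t\<bar>)) \<partial>lborel)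
    = ennreal (exp (- k * b) * ((F c b + F c (- b) + k * (H (b + d) - H (- b + d))) / 2))"
    unfolding b_def by (intro laplace_overlap_nn_integral[OF k]) (auto simp: F_def)
  have "F c b + F c (- b) = E (b + d) + E (- b + d)"
  proof -
    have "F c b + F c (- b) = F d b + F d (- b)"
      using refl[of d b] refl[of d "-b"] by (cases "c \<ge> 0") (auto simp: d_def)
    moreover have "F d b = E (b + d)" "F d (- b) = E (- b + d)"
      using b d by (auto simp: F_def E_def max_def abs_if)
    ultimately show ?thesis by simp
  qed
  moreover have "k * (H (b + d) - H (- b + d)) = k * (min (b + d) a - min (- b + d) a) - E (b + d) + E (- b + d)"
    using k by (simp add: H_def field_simps)
  \<comment> \<open>The value at the atom \<open>b\<close> cancels against the upper boundary term
    of \<open>H\<close>, and the value at \<open>- b\<close> is doubled by the lower one.\<close>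
  ultimately have "(F c b + F c (- b) + k * (H (b + d) - H (- b + d))) / 2
      = E (- b + d) + k * ((min (b + d) a - min (- b + d) a) / 2)"
    by (simp add: field_simps)
  \<comment> \<open>This is half the length of the part of \<open>{d - b..d + b}\<close> below
    \<open>a\<close>, where \<open>E\<close> equals 1.\<close>
  also have "(min (b + d) a - min (- b + d) a) / 2 = max 0 (min b ((a + b - d) / 2))"
    using b d by (auto simp: min_def max_def field_simps)
  \<comment> \<open>If \<open>d \<le> a + b\<close>, then \<open>E (- b + d) = 1\<close>; otherwise
    the outer maximum is 0. In both cases \<open>E (- b + d)\<close> factors out.\<close>
  also have "E (- b + d) + k * max 0 (min b ((a + b - d) / 2))
      = E (- b + d) * (1 + k * max 0 (min b ((a + b - d) / 2)))"
    using b d by (cases "d \<le> a + b") (auto simp: E_def max_def min_def)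
  also have "exp (- k * b) * (E (- b + d) * (1 + k * max 0 (min b ((a + b - d) / 2))))
      = (exp (- k * b) * E (- b + d)) * (1 + k * max 0 (min b ((a + b - d) / 2)))"
    by (simp only: mult.assoc)
  also have "exp (- k * b) * E (- b + d) = exp (- k * max b (d - a))"
    by (auto simp: E_def mult_exp_exp max_def algebra_simps)
  finally show ?thesis using * by (simp only: F_def b_def d_def)
qed

section \<open>The two-dimensional overlap integral\<close>

text \<open>The coordinate with the larger shift is integrated first, because
  \<open>laplace_overlap_exp_excess\<close> asks for \<open>\<bar>t\<bar> \<le> a\<close> with
  \<open>a\<close> the shift already integrated. For
  \<open>\<bar>c\<bar> \<ge> \<bar>t1\<bar> + \<bar>t2\<bar>\<close> the sum inside the absolute
  value never changes sign, and the last factor is 1.\<close>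

lemma laplace_overlap_nn_integral2:
  fixes k t1 t2 c :: real
  assumes k: "k > 0"
  shows "(\<integral>\<^sup>+s1. \<integral>\<^sup>+s2. ennreal (k * exp (- k * (\<bar>s1\<bar> + \<bar>s1 - t1\<bar>)) * (k * exp (- k * (\<bar>s2\<bar> + \<bar>s2 - t2\<bar>)) *
      exp (- k * \<bar>(\<bar>s1\<bar> - \<bar>s1 - t1\<bar>) + (\<bar>s2\<bar> - \<bar>s2 - t2\<bar>) + c\<bar>))) \<partial>lborel \<partial>lborel)
    = ennreal (exp (- k * max (\<bar>t1\<bar> + \<bar>t2\<bar>) \<bar>c\<bar>) *
        (1 + k * max 0 (min (min \<bar>t1\<bar> \<bar>t2\<bar>) ((\<bar>t1\<bar> + \<bar>t2\<bar> - \<bar>c\<bar>) / 2))))"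
    (is "?I t1 t2 = ?V t1 t2")
proof -
  have main: "?I t1 t2 = ?V t1 t2" if le: "\<bar>t1\<bar> \<le> \<bar>t2\<bar>" for t1 t2 :: real
  proof -
    let ?G = "\<lambda>s. exp (- k * max (\<bar>\<bar>s\<bar> - \<bar>s - t1\<bar> + c\<bar> - \<bar>t2\<bar>) 0)"
    have inner: "(\<integral>\<^sup>+s2. ennreal (k * exp (- k * (\<bar>s1\<bar> + \<bar>s1 - t1\<bar>)) * (k * exp (- k * (\<bar>s2\<bar> + \<bar>s2 - t2\<bar>)) *
        exp (- k * \<bar>(\<bar>s1\<bar> - \<bar>s1 - t1\<bar>) + (\<bar>s2\<bar> - \<bar>s2 - t2\<bar>) + c\<bar>))) \<partial>lborel)
      = ennreal (exp (- k * \<bar>t2\<bar>)) * ennreal (k * exp (- k * (\<bar>s1\<bar> + \<bar>s1 - t1\<bar>)) * ?G s1)" for s1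
    proof -
      let ?w = "k * exp (- k * (\<bar>s1\<bar> + \<bar>s1 - t1\<bar>))"
      have "(\<integral>\<^sup>+s2. ennreal (?w * (k * exp (- k * (\<bar>s2\<bar> + \<bar>s2 - t2\<bar>)) *
          exp (- k * \<bar>(\<bar>s1\<bar> - \<bar>s1 - t1\<bar>) + (\<bar>s2\<bar> - \<bar>s2 - t2\<bar>) + c\<bar>))) \<partial>lborel)
        = (\<integral>\<^sup>+s2. ennreal ?w * ennreal (k * exp (- k * (\<bar>s2\<bar> + \<bar>s2 - t2\<bar>)) *
          exp (- k * \<bar>\<bar>s2\<bar> - \<bar>s2 - t2\<bar> + (\<bar>s1\<bar> - \<bar>s1 - t1\<bar> + c)\<bar>)) \<partial>lborel)"
        using k by (intro nn_integral_cong) (simp add: ennreal_mult[symmetric] add.assoc add.left_commute)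
      also have "\<dots> = ennreal ?w * ennreal (exp (- k * \<bar>t2\<bar>) * ?G s1)"
        by (subst nn_integral_cmult) (simp_all only: laplace_overlap_exp_abs[OF k], measurable)
      also have "\<dots> = ennreal (exp (- k * \<bar>t2\<bar>)) * ennreal (?w * ?G s1)"
        using k by (simp add: ennreal_mult[symmetric] mult_ac)
      finally show ?thesis .
    qed
    have "?I t1 t2 = ennreal (exp (- k * \<bar>t2\<bar>)) * ennreal (exp (- k * max \<bar>t1\<bar> (\<bar>c\<bar> - \<bar>t2\<bar>)) *
        (1 + k * max 0 (min \<bar>t1\<bar> ((\<bar>t2\<bar> + \<bar>t1\<bar> - \<bar>c\<bar>) / 2))))"
      unfolding inner by (subst nn_integral_cmult) (simp_all only: laplace_overlap_exp_excess[OF k le], measurable)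
    also have "\<dots> = ennreal ((exp (- k * \<bar>t2\<bar>) * exp (- k * max \<bar>t1\<bar> (\<bar>c\<bar> - \<bar>t2\<bar>))) *
        (1 + k * max 0 (min \<bar>t1\<bar> ((\<bar>t2\<bar> + \<bar>t1\<bar> - \<bar>c\<bar>) / 2))))"
      using k by (simp add: ennreal_mult[symmetric] mult.assoc)
    also have "exp (- k * \<bar>t2\<bar>) * exp (- k * max \<bar>t1\<bar> (\<bar>c\<bar> - \<bar>t2\<bar>)) = exp (- k * max (\<bar>t1\<bar> + \<bar>t2\<bar>) \<bar>c\<bar>)"
    proof -
      have "max (\<bar>t1\<bar> + \<bar>t2\<bar>) \<bar>c\<bar> = \<bar>t2\<bar> + max \<bar>t1\<bar> (\<bar>c\<bar> - \<bar>t2\<bar>)" by (simp add: max_def)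
      then show ?thesis by (simp only: mult_exp_exp distrib_left)
    qed
    finally show ?thesis using le by (simp add: min_absorb1 add.commute)
  qed
  show ?thesis
  proof (cases "\<bar>t1\<bar> \<le> \<bar>t2\<bar>")
    case False
    \<comment> \<open>The integrand is invariant under exchanging \<open>(s1, t1)\<close> with
      \<open>(s2, t2)\<close>; Fubini restores the order of integration.\<close>
    have "?I t1 t2 = ?I t2 t1"
      by (subst lborel_pair.Fubini') (auto intro!: nn_integral_cong simp: mult_ac add_ac)
    then show ?thesis using main[of t2 t1] False by (simp add: min.commute add.commute)
  qed (rule main)
qed

section \<open>From the Poisson points to the law of the moving maximum\<close>

lemma emeasure_unit_intensity_below:
  fixes h :: "real \<Rightarrow> real \<Rightarrow> real"
  assumes h: "(\<lambda>(x, w). h x w) \<in> borel_measurable borel"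
  shows "{(x, w, y). 0 < y \<and> y < h x w} \<in> sets unit_intensity"
    and "emeasure unit_intensity {(x, w, y). 0 < y \<and> y < h x w} = (\<integral>\<^sup>+x. \<integral>\<^sup>+w. ennreal (h x w) \<partial>lborel \<partial>lborel)"
proof -
  let ?B = "{(x :: real, w :: real, y). 0 < y \<and> y < h x w}"
  have hm: "(\<lambda>p :: real \<times> real \<times> real. h (fst p) (fst (snd p))) \<in> borel_measurable borel"
    using measurable_compose[OF _ h, of "\<lambda>p :: real \<times> real \<times> real. (fst p, fst (snd p))" borel]
    by (simp add: borel_measurable_continuous_onI continuous_intros)
  have "?B = {p \<in> space borel. 0 < snd (snd p) \<and> snd (snd p) < h (fst p) (fst (snd p))}" by auto
  also have "\<dots> \<in> sets borel"
    by (intro sets.sets_Collect_conj borel_measurable_less)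
      (simp_all add: hm borel_measurable_continuous_onI continuous_intros)
  finally have B[measurable]: "?B \<in> sets borel" .
  have O: "(UNIV \<times> UNIV \<times> {0<..} :: (real \<times> real \<times> real) set) \<inter> space lborel \<in> sets lborel"
    by (auto intro!: borel_open open_Times)
  show "?B \<in> sets unit_intensity"
    unfolding unit_intensity_def sets_restrict_space_iff[OF O] using B by auto
  have "emeasure unit_intensity ?B = emeasure lborel ?B"
    unfolding unit_intensity_def by (intro emeasure_restrict_space[OF O]) auto
  also have "\<dots> = (\<integral>\<^sup>+p. indicator ?B p \<partial>(lborel \<Otimes>\<^sub>M (lborel \<Otimes>\<^sub>M lborel)))"
    by (simp add: lborel_prod)
  also have "\<dots> = (\<integral>\<^sup>+x. \<integral>\<^sup>+p. indicator ?B (x, p) \<partial>(lborel \<Otimes>\<^sub>M lborel) \<partial>lborel)"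
    unfolding lborel_prod by (intro lborel.nn_integral_fst[symmetric, of _ lborel, unfolded lborel_prod]) simp
  also have "\<dots> = (\<integral>\<^sup>+x. \<integral>\<^sup>+w. \<integral>\<^sup>+y. indicator ?B (x, w, y) \<partial>lborel \<partial>lborel \<partial>lborel)"
    by (intro nn_integral_cong lborel.nn_integral_fst[symmetric]) (simp add: lborel_prod)
  also have "\<dots> = (\<integral>\<^sup>+x. \<integral>\<^sup>+w. ennreal (h x w) \<partial>lborel \<partial>lborel)"
  proof (intro nn_integral_cong)
    fix x w
    have "(\<integral>\<^sup>+y. indicator ?B (x, w, y) \<partial>lborel) = (\<integral>\<^sup>+y. indicator {0<..<h x w} y \<partial>lborel)"
      by (intro nn_integral_cong) (auto simp: indicator_def)
    \<comment> \<open>For negative \<open>h x w\<close> the interval is empty and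
      \<open>ennreal\<close> truncates to 0.\<close>
    also have "\<dots> = ennreal (h x w)" by (cases "h x w \<ge> 0") (auto simp: ennreal_neg)
    finally show "(\<integral>\<^sup>+y. indicator ?B (x, w, y) \<partial>lborel) = ennreal (h x w)" .
  qed
  finally show "emeasure unit_intensity ?B = (\<integral>\<^sup>+x. \<integral>\<^sup>+w. ennreal (h x w) \<partial>lborel \<partial>lborel)" .
qed

text \<open>No index enters \<open>B\<close> exactly when the count is 0, so this is the counting
  law at \<open>k = 0\<close>; the factor \<open>measure \<Lambda> B ^ 0\<close> is 1 even for a
  null set.\<close>

lemma (in prob_space) poisson_process_void_prob:
  assumes "poisson_process \<Lambda> P" "B \<in> sets \<Lambda>" "emeasure \<Lambda> B < \<infinity>"
  shows "prob {\<omega> \<in> space M. \<forall>j. P j \<omega> \<notin> B} = exp (- measure \<Lambda> B)"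
proof -
  have "{\<omega> \<in> space M. \<forall>j. P j \<omega> \<notin> B} = {\<omega> \<in> space M. point_count P B \<omega> = of_nat 0}"
    by (auto simp: point_count_def emeasure_count_space_eq_0)
  moreover have "prob {\<omega> \<in> space M. point_count P B \<omega> = of_nat 0}
      = measure \<Lambda> B ^ 0 / fact 0 * exp (- measure \<Lambda> B)"
    using assms unfolding poisson_process_def by blast
  ultimately show ?thesis by simp
qed

text \<open>A supremum is bounded by \<open>w1\<close> iff every term is, and a term is bounded iff
  the height \<open>Y\<close> is at least the density divided by \<open>w1\<close>. Both bounds
  together keep every point out of the region strictly below the larger graph, which has volume
  \<open>V\<close>.\<close>

lemma (in prob_space) prob_moving_max_le:
  fixes X W Y :: "nat \<Rightarrow> 'a \<Rightarrow> real"
  assumes P: "poisson_process unit_intensity (\<lambda>j \<omega>. (X j \<omega>, W j \<omega>, Y j \<omega>))"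
    and [measurable]: "(\<lambda>(x, w). \<phi> x w) \<in> borel_measurable borel"
    and w: "w1 > 0" "w2 > 0"
    and V: "(\<integral>\<^sup>+x. \<integral>\<^sup>+w. ennreal (max (\<phi> (x - a1) (w - a2) / w1) (\<phi> (x - b1) (w - b2) / w2)) \<partial>lborel \<partial>lborel)
      = ennreal V" "V \<ge> 0"
  shows "prob {\<omega> \<in> space M. moving_max \<phi> X W Y (a1, a2) \<omega> \<le> ereal w1 \<and>
      moving_max \<phi> X W Y (b1, b2) \<omega> \<le> ereal w2} = exp (- V)"
proof -
  define h where "h = (\<lambda>x w. max (\<phi> (x - a1) (w - a2) / w1) (\<phi> (x - b1) (w - b2) / w2))"
  let ?B = "{(x, w, y). 0 < y \<and> y < h x w}"
  have "(\<lambda>p. \<phi> (fst p - c1) (snd p - c2)) \<in> borel_measurable borel" for c1 c2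
    using measurable_compose[OF _ assms(2), of "\<lambda>p :: real \<times> real. (fst p - c1, snd p - c2)" borel]
    by (simp add: borel_measurable_continuous_onI continuous_intros)
  note [measurable] = this
  have h: "(\<lambda>(x, w). h x w) \<in> borel_measurable borel"
    unfolding h_def case_prod_beta by measurable
  note B = emeasure_unit_intensity_below[OF h]
  have B': "emeasure unit_intensity ?B = ennreal V" unfolding B(2) using V(1) by (simp add: h_def)
  \<comment> \<open>Measurability into \<open>unit_intensity\<close> places the points in its space,
    so all heights are positive on \<open>space M\<close> and inequalities may be multiplied by
    them.\<close>
  have Y: "Y j \<omega> > 0" if "\<omega> \<in> space M" for j \<omega>
  proof -
    have "(X j \<omega>, W j \<omega>, Y j \<omega>) \<in> space unit_intensity"
      using P that unfolding poisson_process_def by (auto dest: measurable_space)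
    then show ?thesis by (simp add: unit_intensity_def space_restrict_space)
  qed
  have "{\<omega> \<in> space M. moving_max \<phi> X W Y (a1, a2) \<omega> \<le> ereal w1 \<and> moving_max \<phi> X W Y (b1, b2) \<omega> \<le> ereal w2}
    = {\<omega> \<in> space M. \<forall>j. (X j \<omega>, W j \<omega>, Y j \<omega>) \<notin> ?B}"
  proof (intro Collect_cong conj_cong refl)
    fix \<omega> assume "\<omega> \<in> space M"
    have le_iff: "u / Y j \<omega> \<le> v \<longleftrightarrow> u / v \<le> Y j \<omega>" if "v > 0" for u v j
      using Y[OF \<open>\<omega> \<in> space M\<close>, of j] that by (simp add: field_simps)
    show "(moving_max \<phi> X W Y (a1, a2) \<omega> \<le> ereal w1 \<and> moving_max \<phi> X W Y (b1, b2) \<omega> \<le> ereal w2)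
      = (\<forall>j. (X j \<omega>, W j \<omega>, Y j \<omega>) \<notin> ?B)"
      using Y[OF \<open>\<omega> \<in> space M\<close>] w
      by (simp add: moving_max_def SUP_le_iff h_def not_less le_iff all_conj_distrib)
  qed
  then show ?thesis
    using poisson_process_void_prob[OF P B(1)] B' V(2) by (simp add: measure_def)
qed

section \<open>Integrals of the scaled Laplace densities, of their minimum and of their
  maximum\<close>

lemma nn_integral_laplace_density2:
  fixes \<beta> a b v :: real
  assumes \<beta>: "\<beta> > 0" and v: "v > 0"
  shows "(\<integral>\<^sup>+x. \<integral>\<^sup>+w. ennreal (laplace_density2 \<beta> (x - a) (w - b) / v) \<partial>lborel \<partial>lborel) = ennreal (1 / v)"
proof -
  let ?g = "\<lambda>s. ennreal (\<beta> / 2 * exp (- \<beta> * \<bar>s\<bar>))"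
  have g: "(\<integral>\<^sup>+s. ?g (s - c) \<partial>lborel) = 1" for c
  proof -
    have "(\<integral>\<^sup>+s. ?g (s - c) \<partial>lborel) = (\<integral>\<^sup>+s. ?g s \<partial>lborel)"
      by (subst nn_integral_real_affine[where c = 1 and t = c]) auto
    also have "\<dots> = 1"
      \<comment> \<open>For \<open>t = 0\<close> the overlap weight is the Laplace density itself,
        as \<open>2 * k = \<beta>\<close>; the interval degenerates to a point with
        \<open>I = 0\<close>, and the atoms give \<open>(1 + 1) / 2\<close>.\<close>
      using laplace_overlap_nn_integral[of "\<beta> / 2" "\<lambda>_. 1" 0 0] \<beta> has_integral_refl(2)[of "\<lambda>_. 1 :: real" "0 :: real"] by simp
    finally show ?thesis .
  qed
  have "ennreal (laplace_density2 \<beta> (x - a) (w - b) / v) = ennreal (1 / v) * ?g (x - a) * ?g (w - b)" for x w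
    using \<beta> v by (simp add: laplace_density2_def ennreal_mult[symmetric] mult_exp_exp power2_eq_square algebra_simps)
  moreover have "(\<integral>\<^sup>+s. C * ?g (s - c) \<partial>lborel) = C" for C c
    by (subst nn_integral_cmult) (simp_all only: g mult_1_right, measurable)
  ultimately show ?thesis by (simp only:)
qed

lemma min_exp_exp:
  fixes x y :: real
  shows "min (exp x) (exp y) = exp ((x + y) / 2) * exp (- (\<bar>x - y\<bar> / 2))"
  by (cases "x \<le> y") (auto simp: mult_exp_exp min_def field_simps)

lemma inverse_sqrt_mult_eq_exp:
  fixes v w :: real
  assumes "v > 0" "w > 0"
  shows "1 / sqrt (v * w) = exp (- ((ln v + ln w) / 2))"
proof -
  have "sqrt (v * w) = exp (ln (sqrt (v * w)))" using assms by simp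
  also have "ln (sqrt (v * w)) = (ln v + ln w) / 2" using assms by (simp add: ln_sqrt ln_mult)
  finally show ?thesis by (simp add: exp_minus inverse_eq_divide)
qed

text \<open>\<open>x\<close> and \<open>y\<close> are the logarithms of the scaled densities up to
  the common factor \<open>k\<^sup>2\<close>. Their mean separates into a part for each coordinate
  and a constant giving \<open>1 / sqrt (w1 * w2)\<close>; their half difference is
  \<open>- k * (U + c)\<close>, the only coupling of the coordinates.\<close>

lemma min_laplace_density2:
  fixes \<beta> t1 t2 w1 w2 s1 s2 :: real
  assumes \<beta>: "\<beta> > 0" and w: "w1 > 0" "w2 > 0"
  defines "k \<equiv> \<beta> / 2" and "c \<equiv> ln (w1 / w2) / \<beta>"
  shows "min (laplace_density2 \<beta> s1 s2 / w1) (laplace_density2 \<beta> (s1 - t1) (s2 - t2) / w2)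
    = 1 / sqrt (w1 * w2) * (k * exp (- k * (\<bar>s1\<bar> + \<bar>s1 - t1\<bar>)) * (k * exp (- k * (\<bar>s2\<bar> + \<bar>s2 - t2\<bar>)) *
        exp (- k * \<bar>(\<bar>s1\<bar> - \<bar>s1 - t1\<bar>) + (\<bar>s2\<bar> - \<bar>s2 - t2\<bar>) + c\<bar>)))"
proof -
  define U where "U = (\<bar>s1\<bar> - \<bar>s1 - t1\<bar>) + (\<bar>s2\<bar> - \<bar>s2 - t2\<bar>)"
  define x where "x = - \<beta> * (\<bar>s1\<bar> + \<bar>s2\<bar>) - ln w1"
  define y where "y = - \<beta> * (\<bar>s1 - t1\<bar> + \<bar>s2 - t2\<bar>) - ln w2"
  have k: "k > 0" "\<beta> = 2 * k" using \<beta> by (auto simp: k_def)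
  have c: "2 * k * c = ln w1 - ln w2" using k w by (simp add: c_def ln_div)
  have "x - y = - (2 * k * (U + c))"
    using c by (simp add: x_def y_def U_def k(2) algebra_simps)
  then have half_diff: "\<bar>x - y\<bar> / 2 = k * \<bar>U + c\<bar>"
    using k(1) by (simp add: abs_mult)
  have "laplace_density2 \<beta> s1 s2 / w1 = k\<^sup>2 * exp x"
    using w by (simp add: laplace_density2_def x_def k_def exp_diff power2_eq_square)
  moreover have "laplace_density2 \<beta> (s1 - t1) (s2 - t2) / w2 = k\<^sup>2 * exp y"
    using w by (simp add: laplace_density2_def y_def k_def exp_diff power2_eq_square)
  ultimately have "min (laplace_density2 \<beta> s1 s2 / w1) (laplace_density2 \<beta> (s1 - t1) (s2 - t2) / w2)
      = k\<^sup>2 * min (exp x) (exp y)"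
    using k by (simp add: min_mult_distrib_left)
  also have "min (exp x) (exp y) = exp ((x + y) / 2) * exp (- k * \<bar>U + c\<bar>)"
    by (simp add: min_exp_exp half_diff)
  also have "(x + y) / 2 = - ((ln w1 + ln w2) / 2) + (- k * (\<bar>s1\<bar> + \<bar>s1 - t1\<bar>)) + (- k * (\<bar>s2\<bar> + \<bar>s2 - t2\<bar>))"
    by (simp add: x_def y_def k(2) field_simps)
  finally show ?thesis
    unfolding inverse_sqrt_mult_eq_exp[OF w] U_def exp_add power2_eq_square by (simp only: mult_ac)
qed

text \<open>Maximum plus minimum is the sum of the two scaled densities, whose masses are known, and
  \<open>m\<close> is the integral of the minimum. As \<open>ennreal\<close> subtraction truncates,
  the identity is first proved with \<open>m\<close> added on the left. It also bounds
  \<open>m\<close>, which makes the exponent nonnegative as \<open>prob_moving_max_le\<close>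
  requires.\<close>

lemma nn_integral_max_laplace_density2:
  fixes \<beta> t1 t2 w1 w2 :: real
  assumes \<beta>: "\<beta> > 0" and w: "w1 > 0" "w2 > 0"
  defines "c \<equiv> ln (w1 / w2) / \<beta>"
  defines "m \<equiv> 1 / sqrt (w1 * w2) * (exp (- (\<beta> / 2) * max (\<bar>t1\<bar> + \<bar>t2\<bar>) \<bar>c\<bar>) *
        (1 + \<beta> / 2 * max 0 (min (min \<bar>t1\<bar> \<bar>t2\<bar>) ((\<bar>t1\<bar> + \<bar>t2\<bar> - \<bar>c\<bar>) / 2))))"
  shows "(\<integral>\<^sup>+x. \<integral>\<^sup>+w. ennreal (max (laplace_density2 \<beta> x w / w1) (laplace_density2 \<beta> (x - t1) (w - t2) / w2))
      \<partial>lborel \<partial>lborel) = ennreal (1 / w1 + 1 / w2 - m)"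
    and "m \<le> 1 / w1 + 1 / w2"
proof -
  let ?f = "\<lambda>x w. laplace_density2 \<beta> x w / w1"
  let ?g = "\<lambda>x w. laplace_density2 \<beta> (x - t1) (w - t2) / w2"
  let ?J = "\<lambda>F. \<integral>\<^sup>+x. \<integral>\<^sup>+w. ennreal (F x w) \<partial>lborel \<partial>lborel"
  have J_add: "?J (\<lambda>x w. F x w + G x w) = ?J F + ?J G"
    if [measurable]: "case_prod F \<in> borel_measurable (lborel \<Otimes>\<^sub>M lborel)" "case_prod G \<in> borel_measurable (lborel \<Otimes>\<^sub>M lborel)"
      and "\<And>x w. F x w \<ge> 0" "\<And>x w. G x w \<ge> 0" for F G :: "real \<Rightarrow> real \<Rightarrow> real"
    using that by (simp add: nn_integral_add)
  have pos: "?f x w \<ge> 0" "?g x w \<ge> 0" for x w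
    using w by (auto simp: laplace_density2_def)
  have meas[measurable]: "case_prod ?f \<in> borel_measurable (lborel \<Otimes>\<^sub>M lborel)" "case_prod ?g \<in> borel_measurable (lborel \<Otimes>\<^sub>M lborel)"
    unfolding laplace_density2_def by measurable
  have m0: "m \<ge> 0"
    unfolding m_def using \<beta> w by (intro mult_nonneg_nonneg add_nonneg_nonneg) auto
  have "?J (\<lambda>x w. min (?f x w) (?g x w)) = ennreal (1 / sqrt (w1 * w2)) *
      ennreal (exp (- (\<beta> / 2) * max (\<bar>t1\<bar> + \<bar>t2\<bar>) \<bar>c\<bar>) *
        (1 + \<beta> / 2 * max 0 (min (min \<bar>t1\<bar> \<bar>t2\<bar>) ((\<bar>t1\<bar> + \<bar>t2\<bar> - \<bar>c\<bar>) / 2))))"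
  proof -
    let ?k = "\<beta> / 2"
    let ?h = "\<lambda>s1 s2. ?k * exp (- ?k * (\<bar>s1\<bar> + \<bar>s1 - t1\<bar>)) * (?k * exp (- ?k * (\<bar>s2\<bar> + \<bar>s2 - t2\<bar>)) *
        exp (- ?k * \<bar>(\<bar>s1\<bar> - \<bar>s1 - t1\<bar>) + (\<bar>s2\<bar> - \<bar>s2 - t2\<bar>) + c\<bar>))"
    have "ennreal (min (?f x w) (?g x w)) = ennreal (1 / sqrt (w1 * w2)) * ennreal (?h x w)" for x w
      unfolding min_laplace_density2[OF \<beta> w] c_def using \<beta> w by (intro ennreal_mult) auto
    moreover have "?J (\<lambda>x w. ?h x w) = ennreal (exp (- ?k * max (\<bar>t1\<bar> + \<bar>t2\<bar>) \<bar>c\<bar>) *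
        (1 + ?k * max 0 (min (min \<bar>t1\<bar> \<bar>t2\<bar>) ((\<bar>t1\<bar> + \<bar>t2\<bar> - \<bar>c\<bar>) / 2))))"
      by (rule laplace_overlap_nn_integral2) (use \<beta> in simp)
    moreover have "(\<integral>\<^sup>+x. \<integral>\<^sup>+w. C * ennreal (?h x w) \<partial>lborel \<partial>lborel) = C * ?J (\<lambda>x w. ?h x w)" for C
      by (subst nn_integral_cmult, measurable, subst nn_integral_cmult, measurable)
    ultimately show ?thesis by (simp only:)
  qed
  also have "\<dots> = ennreal m"
    unfolding m_def using \<beta> w by (intro ennreal_mult[symmetric]) auto
  finally have "?J (\<lambda>x w. max (?f x w) (?g x w)) + ennreal m
      = ?J (\<lambda>x w. max (?f x w) (?g x w)) + ?J (\<lambda>x w. min (?f x w) (?g x w))" by simp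
  also have "\<dots> = ?J (\<lambda>x w. max (?f x w) (?g x w) + min (?f x w) (?g x w))"
  proof (rule J_add[symmetric])
    show "(\<lambda>(x, w). max (?f x w) (?g x w)) \<in> borel_measurable (lborel \<Otimes>\<^sub>M lborel)"
      "(\<lambda>(x, w). min (?f x w) (?g x w)) \<in> borel_measurable (lborel \<Otimes>\<^sub>M lborel)"
      unfolding laplace_density2_def by measurable
  qed (simp_all only: le_max_iff_disj min.bounded_iff pos simp_thms)
  also have "\<dots> = ?J (\<lambda>x w. ?f x w + ?g x w)"
    by (simp only: max_def min_def) (intro nn_integral_cong, auto simp: add.commute)
  also have "\<dots> = ?J ?f + ?J ?g"
    by (rule J_add[OF meas pos])
  also have "\<dots> = ennreal (1 / w1) + ennreal (1 / w2)"
    using nn_integral_laplace_density2[OF \<beta> w(1), of 0 0] nn_integral_laplace_density2[OF \<beta> w(2), of t1 t2] by simp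
  also have "\<dots> = ennreal (1 / w1 + 1 / w2)" using w by simp
  finally have eq: "?J (\<lambda>x w. max (?f x w) (?g x w)) + ennreal m = ennreal (1 / w1 + 1 / w2)" .
  have "ennreal m \<le> ?J (\<lambda>x w. max (?f x w) (?g x w)) + ennreal m"
    by (rule add_increasing) simp_all
  also note eq
  finally have "ennreal m \<le> ennreal (1 / w1 + 1 / w2)" .
  then show le: "m \<le> 1 / w1 + 1 / w2" using w by (subst (asm) ennreal_le_iff) auto
  have "?J (\<lambda>x w. max (?f x w) (?g x w)) = ennreal (1 / w1 + 1 / w2) - ennreal m"
    unfolding eq[symmetric] by simp
  then show "?J (\<lambda>x w. max (?f x w) (?g x w)) = ennreal (1 / w1 + 1 / w2 - m)"
    using m0 by (simp add: ennreal_minus)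
qed

section \<open>Reading the five cases off the closed form of the exponent\<close>

theorem proposition2p4:
  fixes \<beta> t1 t2 w1 w2 :: real
    and M :: "'a measure"
    and X W Y :: "nat \<Rightarrow> 'a \<Rightarrow> real"
    and Z :: "real \<times> real \<Rightarrow> 'a \<Rightarrow> ereal"
    and L :: real
  assumes "\<beta> > 0"
    and "prob_space M"
    and "prob_space.poisson_process M unit_intensity (\<lambda>j \<omega>. (X j \<omega>, W j \<omega>, Y j \<omega>))"
    and "w1 > 0" and "w2 > 0"
  defines "Z \<equiv> moving_max (laplace_density2 \<beta>) X W Y"
  defines "L \<equiv> - ln (measure M {\<omega> \<in> space M. Z (0, 0) \<omega> \<le> ereal w1 \<and> Z (t1, t2) \<omega> \<le> ereal w2})"
  shows "((w1, w2) \<in> A1 \<beta> t1 t2 \<longrightarrow> L = 1 / w1) \<and>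
    ((w1, w2) \<in> A2 \<beta> t1 t2 \<longrightarrow>
       L = 1 / w1 + 1 / w2 - 1 / sqrt (w1 * w2) * exp (- \<beta> * (\<bar>t1\<bar> + \<bar>t2\<bar>) / 2) *
             (1 + \<beta> * ((\<bar>t1\<bar> + \<bar>t2\<bar>) / 4) + 1 / 4 * ln (w1 / w2))) \<and>
    ((w1, w2) \<in> A3 \<beta> t1 t2 \<longrightarrow>
       L = 1 / w1 + 1 / w2 - 1 / sqrt (w1 * w2) * exp (- \<beta> * (\<bar>t1\<bar> + \<bar>t2\<bar>) / 2) *
             (1 + \<beta> * (min \<bar>t1\<bar> \<bar>t2\<bar> / 2))) \<and>
    ((w1, w2) \<in> A4 \<beta> t1 t2 \<longrightarrow>
       L = 1 / w1 + 1 / w2 - 1 / sqrt (w1 * w2) * exp (- \<beta> * (\<bar>t1\<bar> + \<bar>t2\<bar>) / 2) *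
             (1 + \<beta> * ((\<bar>t1\<bar> + \<bar>t2\<bar>) / 4) + 1 / 4 * ln (w2 / w1))) \<and>
    ((w1, w2) \<in> A5 \<beta> t1 t2 \<longrightarrow> L = 1 / w2)"
proof -
  interpret prob_space M by fact
  define a where "a = \<bar>t1\<bar>"
  define b where "b = \<bar>t2\<bar>"
  define c where "c = ln (w1 / w2) / \<beta>"
  define m where "m = 1 / sqrt (w1 * w2) * (exp (- (\<beta> / 2) * max (a + b) \<bar>c\<bar>) *
        (1 + \<beta> / 2 * max 0 (min (min a b) ((a + b - \<bar>c\<bar>) / 2))))"
  note J = nn_integral_max_laplace_density2[OF \<open>\<beta> > 0\<close> \<open>w1 > 0\<close> \<open>w2 > 0\<close>, of t1 t2, folded c_def a_def b_def, folded m_def]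
  have "(\<lambda>(x, w). laplace_density2 \<beta> x w) \<in> borel_measurable borel"
    unfolding laplace_density2_def case_prod_beta
    by (intro borel_measurable_continuous_onI continuous_intros)
  then have "prob {\<omega> \<in> space M. Z (0, 0) \<omega> \<le> ereal w1 \<and> Z (t1, t2) \<omega> \<le> ereal w2} = exp (- (1 / w1 + 1 / w2 - m))"
    unfolding Z_def using J assms by (intro prob_moving_max_le) simp_all
  then have L: "L = 1 / w1 + 1 / w2 - m"
    by (simp add: L_def)
  have ab: "a \<ge> 0" "b \<ge> 0" by (auto simp: a_def b_def)
  have c: "1 / \<beta> * ln (w1 / w2) = c" and ln12: "ln (w1 / w2) = \<beta> * c" and ln21: "ln (w2 / w1) = - (\<beta> * c)"
    using assms by (auto simp: c_def ln_div)
  note sqrt_exp = inverse_sqrt_mult_eq_exp[OF \<open>w1 > 0\<close> \<open>w2 > 0\<close>]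
  have "L = 1 / w1" if "(w1, w2) \<in> A1 \<beta> t1 t2"
  proof -
    \<comment> \<open>Here \<open>\<bar>c\<bar>\<close> exceeds \<open>a + b\<close>, so the bracket
      in \<open>m\<close> is 1 and \<open>m\<close> collapses to \<open>1 / w2\<close>: the second
      scaled density lies below the first everywhere.\<close>
    from that have cc: "c < - (a + b)" by (simp add: A1_def c a_def b_def del: times_divide_eq_left)
    with ab have "m = exp (- ((ln w1 + ln w2) / 2)) * exp (\<beta> / 2 * c)"
      by (simp add: m_def sqrt_exp)
    also have "\<dots> = exp (- ln w2)"
      using ln12 assms by (simp add: mult_exp_exp ln_div field_simps)
    finally show ?thesis using \<open>w2 > 0\<close> by (simp add: L exp_minus inverse_eq_divide)
  qed
  moreover have "L = 1 / w2" if "(w1, w2) \<in> A5 \<beta> t1 t2"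
  proof -
    \<comment> \<open>The mirror image, with \<open>m = 1 / w1\<close>; at equality the bracket is 1
      as well.\<close>
    from that have cc: "c \<ge> a + b" by (simp add: A5_def c a_def b_def del: times_divide_eq_left)
    with ab have "m = exp (- ((ln w1 + ln w2) / 2)) * exp (- (\<beta> / 2 * c))"
      by (simp add: m_def sqrt_exp)
    also have "\<dots> = exp (- ln w1)"
      using ln12 assms by (simp add: mult_exp_exp ln_div field_simps)
    finally show ?thesis using \<open>w1 > 0\<close> by (simp add: L exp_minus inverse_eq_divide)
  qed
  \<comment> \<open>The three middle regions share this form; \<open>q\<close> is whichever argument
    of the \<open>min\<close> is smallest.\<close>
  moreover have "L = 1 / w1 + 1 / w2 - 1 / sqrt (w1 * w2) * exp (- \<beta> * (\<bar>t1\<bar> + \<bar>t2\<bar>) / 2) *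
      (1 + \<beta> / 2 * q)"
    if "\<bar>c\<bar> \<le> a + b" "min (min a b) ((a + b - \<bar>c\<bar>) / 2) = q" for q
  proof -
    have "max 0 q = q" "max (a + b) \<bar>c\<bar> = a + b" using that ab by auto
    then show ?thesis unfolding L m_def that(2) by (simp add: a_def b_def)
  qed
  \<comment> \<open>As \<open>ln (w1 / w2) = \<beta> * c\<close>, the quarter logarithms are
    \<open>\<beta> / 2 * (c / 2)\<close> up to sign.\<close>
  moreover have "1 + \<beta> * ((\<bar>t1\<bar> + \<bar>t2\<bar>) / 4) + 1 / 4 * ln (w1 / w2) = 1 + \<beta> / 2 * ((a + b + c) / 2)"
    "1 + \<beta> * ((\<bar>t1\<bar> + \<bar>t2\<bar>) / 4) + 1 / 4 * ln (w2 / w1) = 1 + \<beta> / 2 * ((a + b - c) / 2)"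
    "1 + \<beta> * (min \<bar>t1\<bar> \<bar>t2\<bar> / 2) = 1 + \<beta> / 2 * min a b"
    unfolding ln12 ln21 by (simp_all add: a_def b_def field_simps)
  \<comment> \<open>The quantity \<open>(a + b - \<bar>c\<bar>) / 2\<close> is at most
    \<open>min a b\<close> exactly when \<open>\<bar>c\<bar> \<ge> max a b - min a b\<close>. This
    threshold separates \<open>A3\<close> from \<open>A2\<close>, where \<open>c\<close> is
    negative, and from \<open>A4\<close>, where it is nonnegative.\<close>
  moreover have "\<bar>c\<bar> \<le> a + b \<and> min (min a b) ((a + b - \<bar>c\<bar>) / 2) = (a + b + c) / 2" if "(w1, w2) \<in> A2 \<beta> t1 t2"
  proof -
    from that have "- (a + b) \<le> c" "c < min a b - max a b"
      by (simp_all add: A2_def c a_def b_def del: times_divide_eq_left)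
    then show ?thesis using ab by (auto simp: min_def max_def split: if_splits)
  qed
  moreover have "\<bar>c\<bar> \<le> a + b \<and> min (min a b) ((a + b - \<bar>c\<bar>) / 2) = min a b" if "(w1, w2) \<in> A3 \<beta> t1 t2"
  proof -
    from that have "min a b - max a b \<le> c" "c < max a b - min a b"
      by (simp_all add: A3_def c a_def b_def del: times_divide_eq_left)
    then show ?thesis using ab by (auto simp: min_def max_def split: if_splits)
  qed
  moreover have "\<bar>c\<bar> \<le> a + b \<and> min (min a b) ((a + b - \<bar>c\<bar>) / 2) = (a + b - c) / 2" if "(w1, w2) \<in> A4 \<beta> t1 t2"
  proof -
    from that have "max a b - min a b \<le> c" "c < a + b"
      by (simp_all add: A4_def c a_def b_def del: times_divide_eq_left)
    then show ?thesis using ab by (auto simp: min_def max_def split: if_splits)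
  qed
  ultimately show ?thesis
    by (simp only:) blast
qed

end
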